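(* Let $G$ be a finite group and let $H$ be a normal subgroup of $G$. Then the normal subgroup based power graph $\Gamma_H(G)$ is complete if and only if $G/H$ is a cyclic group of order $1$ or $p^m$ for some prime number $p$ and some $m\in\mathbb{N}$.
   Context: For a finite group $G$ with identity $e$ and a normal subgroup $H$ of $G$, the normal subgroup based power graph $\Gamma_H(G)$ is the simple undirected graph with vertex set $V(\Gamma_H(G))=(G\setminus H)\cup\{e\}$, in which two distinct vertices $x,y$ are adjacent if and only if $xH=y^mH$ or $yH=x^nH$ for some $m,n\in\mathbb{N}$. Here $\mathbb{N}$ denotes the positive integers. A graph is complete if every two distinct vertices are adjacent. *)

theory Defs
  imports
    "HOL-Algebra.Algebra"
    "HOL-Computational_Algebra.Primes"
    "Graph_Theory.Kuratowski"
begin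

text \<open>As in \<^theory>\<open>Graph_Theory.Digraph\<close>, an undirected graph is a symmetric digraph: the edge
  joining \<open>x\<close> and \<open>y\<close> is the pair of arcs \<open>(x, y)\<close> and \<open>(y, x)\<close>.\<close>

definition normal_subgroup_power_graph ::
    "('a, 'b) monoid_scheme \<Rightarrow> 'a set \<Rightarrow> 'a pair_pre_digraph" where
  "normal_subgroup_power_graph G H =
    (let V = (carrier G - H) \<union> {\<one>\<^bsub>G\<^esub>} in
     \<lparr> pverts = V,
       parcs = {(x, y). x \<in> V \<and> y \<in> V \<and> x \<noteq> y \<and>
         ((\<exists>m::nat. m > 0 \<and> x <#\<^bsub>G\<^esub> H = (y [^]\<^bsub>G\<^esub> m) <#\<^bsub>G\<^esub> H) \<or>
          (\<exists>n::nat. n > 0 \<and> y <#\<^bsub>G\<^esub> H = (x [^]\<^bsub>G\<^esub> n) <#\<^bsub>G\<^esub> H))} \<rparr>)"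

lemma (in group) pair_graph_normal_subgroup_power_graph:
  assumes "finite (carrier G)"
  shows "pair_graph (normal_subgroup_power_graph G H)"
proof -
  let ?P = "normal_subgroup_power_graph G H"
  have fin: "finite (pverts ?P)"
    using assms by (simp add: normal_subgroup_power_graph_def Let_def)
  have sub: "parcs ?P \<subseteq> pverts ?P \<times> pverts ?P"
    by (auto simp: normal_subgroup_power_graph_def Let_def)
  have "finite (parcs ?P)"
    using finite_subset[OF sub] fin by simp
  moreover have "symmetric (with_proj ?P)"
    unfolding symmetric_def with_proj_simps
    by (rule symI) (auto simp: normal_subgroup_power_graph_def Let_def)
  ultimately show ?thesis
    using fin sub
    by unfold_locales (auto simp: normal_subgroup_power_graph_def Let_def)
qed

text \<open>The library's complete graph predicate takes the number of vertices as a parameter. For simple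
  graphs this is adjacency of all distinct vertices, see the lemma below.\<close>

definition complete_graph :: "('a, 'b) pre_digraph \<Rightarrow> bool" where
  "complete_graph G \<longleftrightarrow> complete_digraph (card (verts G)) G"

lemma (in graph) complete_graph_iff:
  "complete_graph G \<longleftrightarrow> (\<forall>u \<in> verts G. \<forall>v \<in> verts G. u \<noteq> v \<longrightarrow> (u, v) \<in> arcs_ends G)"
proof -
  have "graph G" by unfold_locales
  moreover have "(u, v) \<in> arcs_ends G \<Longrightarrow> u \<in> verts G \<and> v \<in> verts G \<and> u \<noteq> v" for u v
    by (auto simp: arcs_ends_conv no_loops)
  ultimately show ?thesis
    unfolding complete_graph_def complete_digraph_def by auto
qed

end

theory Submission
  imports Defs "HOL-Number_Theory.Cong"
begin

text \<open>Every coset of \<open>H\<close> is represented by a vertex, and vertices in the same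
  coset are adjacent, so completeness says that of any two elements of \<open>G/H\<close> one is a power of the
  other. In a finite group \<open>Q\<close> with this property an element of maximal order generates \<open>Q\<close>, and
  elements of distinct prime orders \<open>p\<close> and \<open>q\<close> cannot both exist. Conversely, if \<open>g\<close> generates
  \<open>Q\<close> and has order \<open>p\<^sup>m\<close>, then \<open>g\<^sup>b\<close> is a power of \<open>g\<^sup>a\<close> iff \<open>gcd(a, p\<^sup>m)\<close> divides \<open>b\<close>, and the
  divisors of \<open>p\<^sup>m\<close> form a chain.\<close>

text \<open>Split off the full power of one prime divisor \<open>p\<close>. A prime divisor of the
  cofactor would also divide \<open>n\<close>, hence equal \<open>p\<close>, which the cofactor
  excludes.\<close>

lemma prime_power_if_unique_prime_divisor:
  fixes n :: nat
  assumes "n > 1"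
    and unique: "\<And>p q. \<lbrakk>Factorial_Ring.prime p; Factorial_Ring.prime q; p dvd n; q dvd n\<rbrakk> \<Longrightarrow> p = q"
  shows "\<exists>p m. Factorial_Ring.prime p \<and> m > 0 \<and> n = p ^ m"
proof -
  obtain p where p: "Factorial_Ring.prime p" "p dvd n"
    using \<open>n > 1\<close> prime_factor_nat[of n] by auto
  obtain y where y: "n = p ^ multiplicity p n * y" "\<not> p dvd y"
    using multiplicity_decompose'[of n p] p \<open>n > 1\<close> by (auto simp: prime_nat_iff)
  have "y = 1"
  proof (rule ccontr)
    assume "y \<noteq> 1"
    then obtain q where q: "Factorial_Ring.prime q" "q dvd y"
      using prime_factor_nat by blast
    then have "q dvd n"
      using y(1) dvd_mult by metis
    then show False
      using unique[OF p(1) q(1) p(2)] q(2) y(2) by simp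
  qed
  then have "n = p ^ multiplicity p n"
    using y(1) by simp
  moreover from this have "multiplicity p n > 0"
    using \<open>n > 1\<close> by (metis gr0I less_irrefl power_0)
  ultimately show ?thesis
    using p(1) by blast
qed

definition (in group) positive_power_of :: "'a \<Rightarrow> 'a \<Rightarrow> bool" where
  "positive_power_of x y \<longleftrightarrow> (\<exists>n::nat. n > 0 \<and> x = y [^] n)"

text \<open>Adding \<open>ord y\<close> to the exponent leaves the power unchanged and makes the
  exponent positive, so exponent 0 is covered.\<close>

lemma (in group) nat_pow_positive_power_of:
  assumes "finite (carrier G)" "y \<in> carrier G"
  shows "positive_power_of (y [^] (n::nat)) y"
proof -
  have "y [^] n = y [^] (n + ord y)"
    using assms by (simp flip: nat_pow_mult)
  moreover have "n + ord y > 0"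
    using ord_ge_1[OF assms] by simp
  ultimately show ?thesis
    unfolding positive_power_of_def by blast
qed

lemma (in group) ord_dvd_if_positive_power_of:
  assumes "positive_power_of x y" "y \<in> carrier G"
  shows "ord x dvd ord y"
proof -
  obtain n :: nat where "x = y [^] n"
    using assms(1) unfolding positive_power_of_def by blast
  then have "x [^] ord y = \<one>"
    using assms(2) by (metis mult.commute nat_pow_one nat_pow_pow pow_ord_eq_1)
  then show ?thesis
    using \<open>x = y [^] n\<close> assms(2) by (simp add: pow_eq_id)
qed

text \<open>\<open>cyclic_group\<close> speaks of integer powers of a generator. Finiteness turns
  these first into natural and then into positive powers, as adjacency demands.\<close>

lemma (in group) cyclic_group_iff_positive_powers:
  assumes "finite (carrier G)"
  shows "cyclic_group G \<longleftrightarrow> (\<exists>g\<in>carrier G. \<forall>x\<in>carrier G. positive_power_of x g)"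
proof -
  have "(carrier G = range (\<lambda>n::int. g [^] n)) \<longleftrightarrow> (\<forall>x\<in>carrier G. positive_power_of x g)"
    if g: "g \<in> carrier G" for g
  proof -
    have "range (\<lambda>n::int. g [^] n) = generate G {g}"
      using generate_pow[OF g] by auto
    also have "\<dots> = {g [^] n | n. n \<in> (UNIV :: nat set)}"
      using generate_pow_on_finite_carrier[OF assms g] by auto
    also have "\<dots> = {x. positive_power_of x g}"
      using nat_pow_positive_power_of[OF assms g] by (auto simp: positive_power_of_def)
    finally have "range (\<lambda>n::int. g [^] n) = {x. positive_power_of x g}" .
    moreover have "{x. positive_power_of x g} \<subseteq> carrier G"
      using g by (auto simp: positive_power_of_def)
    ultimately show ?thesis
      by auto
  qed
  then show ?thesis
    unfolding cyclic_group by blast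
qed

lemma (in group) ord_eq_order_if_generator:
  assumes "finite (carrier G)" "g \<in> carrier G" "\<forall>x\<in>carrier G. positive_power_of x g"
  shows "ord g = order G"
proof -
  have "carrier G = generate G {g}"
    using assms generate_pow_on_finite_carrier[OF assms(1,2)]
    by (auto simp: positive_power_of_def)
  then show ?thesis
    using generate_pow_card[OF assms(2)] by (simp add: order_def)
qed

lemma (in group) nat_pow_eq_if_cong_ord:
  assumes "x \<in> carrier G" "[a = b] (mod ord x)"
  shows "x [^] (a::nat) = x [^] (b::nat)"
proof -
  \<comment> \<open>The exponents are compared as integers because subtraction truncates on the
    naturals.\<close>
  have "int (ord x) dvd int b - int a"
    using assms(2) by (metis cong_iff_dvd_diff cong_int_iff cong_sym)
  then have "x [^] int a = x [^] int b"
    using int_pow_eq[OF assms(1)] by blast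
  then show ?thesis
    by (simp add: int_pow_int)
qed

lemma (in group) cyclic_if_pairwise_powers:
  assumes fin: "finite (carrier G)"
    and powers: "\<And>x y. \<lbrakk>x \<in> carrier G; y \<in> carrier G\<rbrakk> \<Longrightarrow>
      positive_power_of x y \<or> positive_power_of y x"
  shows "cyclic_group G"
proof -
  have "Max (ord ` carrier G) \<in> ord ` carrier G"
    using fin by (intro Max_in) auto
  then obtain g where g: "g \<in> carrier G" and "ord g = Max (ord ` carrier G)"
    by auto
  then have max: "ord y \<le> ord g" if "y \<in> carrier G" for y
    using fin that by simp
  have "positive_power_of y g" if y: "y \<in> carrier G" for y
  proof (rule ccontr)
    assume no: "\<not> positive_power_of y g"
    then obtain n :: nat where n: "g = y [^] n"
      using powers[OF y g] unfolding positive_power_of_def by blast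
    have "ord g dvd ord y"
      using powers[OF y g] no ord_dvd_if_positive_power_of y by blast
    then have "ord g = ord y"
      using max[OF y] ord_ge_1[OF fin y] by (meson dvd_imp_le le_antisym less_le_trans zero_less_one)
    \<comment> \<open>Since \<open>g\<close> is \<open>y [^] n\<close> and has the same order as
      \<open>y\<close>, the exponent \<open>n\<close> is a unit modulo that order. Its inverse
      \<open>k\<close> recovers \<open>y\<close> as a power of \<open>g\<close>.\<close>
    then have "coprime n (ord y)"
      using pow_ord_eq_ord_iff[OF fin y] n by simp
    then obtain k where "[n * k = 1] (mod ord y)"
      using cong_solve_coprime_nat by auto
    then have "g [^] k = y"
      using nat_pow_eq_if_cong_ord[OF y] n y by (metis nat_pow_eone nat_pow_pow)
    then show False
      using no nat_pow_positive_power_of[OF fin g] by metis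
  qed
  then show ?thesis
    using g cyclic_group_iff_positive_powers[OF fin] by blast
qed

lemma (in group) order_prime_power_if_pairwise_powers:
  assumes fin: "finite (carrier G)"
    and powers: "\<And>x y. \<lbrakk>x \<in> carrier G; y \<in> carrier G\<rbrakk> \<Longrightarrow>
      positive_power_of x y \<or> positive_power_of y x"
  shows "order G = 1 \<or> (\<exists>p m. Factorial_Ring.prime p \<and> m > 0 \<and> order G = p ^ m)"
proof (cases "order G = 1")
  case False
  then have gt1: "order G > 1"
    using fin order_gt_0_iff_finite by linarith
  obtain g where g: "g \<in> carrier G" "ord g = order G"
    using cyclic_if_pairwise_powers[OF assms] cyclic_group_iff_positive_powers[OF fin]
      ord_eq_order_if_generator[OF fin] by blast
  \<comment> \<open>The witness is the power of the generator with exponent \<open>order G\<close>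
    divided by \<open>p\<close>.\<close>
  have elem: "\<exists>x\<in>carrier G. ord x = p" if "p dvd order G" for p
  proof -
    obtain k where k: "order G = p * k"
      using \<open>p dvd order G\<close> by auto
    then have "k \<noteq> 0"
      using gt1 by (intro notI) simp
    then have "ord (g [^] k) = p"
      using ord_pow[of g k] g k by simp
    then show ?thesis
      using g(1) by blast
  qed
  have "p = q"
    if pq: "Factorial_Ring.prime p" "Factorial_Ring.prime q" "p dvd order G" "q dvd order G"
    for p q
  proof -
    obtain x y where "x \<in> carrier G" "y \<in> carrier G" "ord x = p" "ord y = q"
      using elem pq by meson
    then have "p dvd q \<or> q dvd p"
      using powers ord_dvd_if_positive_power_of by metis
    then show ?thesis
      using pq primes_dvd_imp_eq by metis
  qed
  then show ?thesis
    using prime_power_if_unique_prime_divisor[OF gt1] by blast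
qed simp

text \<open>The exponent \<open>m\<close> may be 0, so the trivial group is included.\<close>

lemma (in group) pairwise_powers_if_cyclic_prime_power:
  assumes fin: "finite (carrier G)" and "cyclic_group G"
    and p: "Factorial_Ring.prime p" and ord: "order G = p ^ m"
    and x: "x \<in> carrier G" and y: "y \<in> carrier G"
  shows "positive_power_of x y \<or> positive_power_of y x"
proof -
  obtain g where g: "g \<in> carrier G" "\<forall>x\<in>carrier G. positive_power_of x g"
    using assms(2) cyclic_group_iff_positive_powers[OF fin] by blast
  have ordg: "ord g = p ^ m"
    using ord_eq_order_if_generator[OF fin g] ord by simp
  obtain a b :: nat where a: "x = g [^] a" and b: "y = g [^] b"
    using g(2) x y unfolding positive_power_of_def by blast
  \<comment> \<open>The linear congruence for \<open>k\<close> is solvable because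
    \<open>gcd c (p ^ m)\<close> divides \<open>d\<close>. Taking the gcd of \<open>d\<close> as
    well makes the condition a comparison of two divisors of \<open>p ^ m\<close>.\<close>
  have power: "positive_power_of (g [^] d) (g [^] c)"
    if "gcd c (p ^ m) dvd gcd d (p ^ m)" for c d :: nat
  proof -
    obtain k where "[c * k = d] (mod p ^ m)"
      using cong_solve_dvd_nat[of c "p ^ m" d] \<open>gcd c (p ^ m) dvd gcd d (p ^ m)\<close> by auto
    then have "g [^] d = (g [^] c) [^] k"
      using nat_pow_eq_if_cong_ord[OF g(1)] g(1) ordg by (metis nat_pow_pow)
    then show ?thesis
      using nat_pow_positive_power_of[OF fin] g(1) by simp
  qed
  obtain i j where "gcd a (p ^ m) = p ^ i" "gcd b (p ^ m) = p ^ j"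
    using p by (metis divides_primepow_nat gcd_dvd2)
  then have "gcd a (p ^ m) dvd gcd b (p ^ m) \<or> gcd b (p ^ m) dvd gcd a (p ^ m)"
    using le_imp_power_dvd nat_le_linear by metis
  then show ?thesis
    using power a b by blast
qed

text \<open>The graph is stated with left cosets, the quotient with right cosets. Normality
  identifies them, and powers in the quotient are computed on representatives.\<close>

lemma (in normal) lcoset_eq_nat_pow_iff:
  assumes "x \<in> carrier G" "y \<in> carrier G"
  shows "(\<exists>n::nat. n > 0 \<and> x <# H = (y [^] n) <# H) \<longleftrightarrow>
    group.positive_power_of (G Mod H) (H #> x) (H #> y)"
proof -
  have "x <# H = (y [^] n) <# H \<longleftrightarrow> H #> x = (H #> y) [^]\<^bsub>G Mod H\<^esub> n" for n :: nat
    using FactGroup_pow[OF assms(2)] assms coset_eq by (metis nat_pow_closed)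
  then show ?thesis
    unfolding group.positive_power_of_def[OF factorgroup_is_group] by simp
qed

lemma (in normal) complete_normal_subgroup_power_graph_iff:
  assumes fin: "finite (carrier G)"
  shows "complete_graph (with_proj (normal_subgroup_power_graph G H)) \<longleftrightarrow>
    (\<forall>A\<in>carrier (G Mod H). \<forall>B\<in>carrier (G Mod H).
      group.positive_power_of (G Mod H) A B \<or> group.positive_power_of (G Mod H) B A)"
proof -
  interpret Q: group "G Mod H"
    by (rule factorgroup_is_group)
  interpret P: pair_graph "normal_subgroup_power_graph G H"
    by (rule pair_graph_normal_subgroup_power_graph[OF fin])
  define V where "V = (carrier G - H) \<union> {\<one>}"
  have V: "x \<in> carrier G" if "x \<in> V" for x
    using that unfolding V_def by auto
  have complete: "complete_graph (with_proj (normal_subgroup_power_graph G H)) \<longleftrightarrow>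
    (\<forall>x\<in>V. \<forall>y\<in>V. x \<noteq> y \<longrightarrow>
      Q.positive_power_of (H #> x) (H #> y) \<or> Q.positive_power_of (H #> y) (H #> x))"
    unfolding P.complete_graph_iff
    by (simp add: normal_subgroup_power_graph_def Let_def lcoset_eq_nat_pow_iff V
        flip: V_def del: Un_insert_right)
  \<comment> \<open>Completeness concerns distinct vertices only, whereas the quotient condition
    also compares a coset with itself. Exponent 1 settles that case.\<close>
  have refl: "Q.positive_power_of A A" if "A \<in> carrier (G Mod H)" for A
    using that unfolding Q.positive_power_of_def
    by (intro exI[of _ 1] conjI zero_less_one Q.nat_pow_eone[symmetric])
  have cosets: "carrier (G Mod H) = (\<lambda>x. H #> x) ` V"
  proof
    show "carrier (G Mod H) \<subseteq> (\<lambda>x. H #> x) ` V"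
    proof
      fix A assume "A \<in> carrier (G Mod H)"
      then obtain x where x: "x \<in> carrier G" "A = H #> x"
        unfolding carrier_FactGroup by blast
      show "A \<in> (\<lambda>x. H #> x) ` V"
      proof (cases "x \<in> H")
        \<comment> \<open>The vertex set keeps only the identity from \<open>H\<close>, which is
          enough to represent the coset \<open>H\<close> itself.\<close>
        case True
        then have "A = H #> \<one>"
          using x by (simp add: coset_join2 subgroup_axioms subset)
        then show ?thesis
          unfolding V_def by blast
      qed (use x in \<open>auto simp: V_def\<close>)
    qed
  qed (use V in \<open>auto simp: carrier_FactGroup\<close>)
  have "Q.positive_power_of (H #> x) (H #> x)" if "x \<in> V" for x
    using that refl cosets by simp
  then have "(x \<noteq> y \<longrightarrow>
      Q.positive_power_of (H #> x) (H #> y) \<or> Q.positive_power_of (H #> y) (H #> x)) \<longleftrightarrow>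
      Q.positive_power_of (H #> x) (H #> y) \<or> Q.positive_power_of (H #> y) (H #> x)"
    if "x \<in> V" for x y
    using that by (cases "x = y") simp_all
  then show ?thesis
    unfolding complete cosets ball_simps by (intro ball_cong HOL.refl)
qed

theorem theorem3p1:
  fixes G :: "('a, 'b) monoid_scheme" and H :: "'a set"
  assumes "group G" and "finite (carrier G)" and "H \<lhd> G"
  shows "complete_graph (with_proj (normal_subgroup_power_graph G H)) \<longleftrightarrow>
    cyclic_group (G Mod H) \<and>
    (order (G Mod H) = 1 \<or>
     (\<exists>(p::nat) (m::nat). Factorial_Ring.prime p \<and> m > 0 \<and> order (G Mod H) = p ^ m))"
proof -
  interpret normal H G
    by fact
  interpret Q: group "G Mod H"
    by (rule factorgroup_is_group)
  have fin: "finite (carrier (G Mod H))"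
    using assms(2) by (simp add: carrier_FactGroup)
  \<comment> \<open>Order 1 is read as 2 to the power 0, so both alternatives become prime
    powers.\<close>
  have prime_power: "\<exists>p m. Factorial_Ring.prime p \<and> order (G Mod H) = p ^ m"
    if "order (G Mod H) = 1"
    using that two_is_prime_nat by (metis power_0)
  show ?thesis
    unfolding complete_normal_subgroup_power_graph_iff[OF assms(2)]
  proof (intro iffI conjI ballI; (elim conjE)?)
    fix A B
    assume cyclic: "cyclic_group (G Mod H)"
      and "order (G Mod H) = 1 \<or>
        (\<exists>(p::nat) (m::nat). Factorial_Ring.prime p \<and> m > 0 \<and> order (G Mod H) = p ^ m)"
      and AB: "A \<in> carrier (G Mod H)" "B \<in> carrier (G Mod H)"
    then obtain p m where "Factorial_Ring.prime p" "order (G Mod H) = p ^ m"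
      using prime_power by blast
    then show "Q.positive_power_of A B \<or> Q.positive_power_of B A"
      using Q.pairwise_powers_if_cyclic_prime_power[OF fin cyclic] AB by blast
  qed (use Q.cyclic_if_pairwise_powers[OF fin] Q.order_prime_power_if_pairwise_powers[OF fin]
      in blast)+
qed

end
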